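(* Let $(S,\mathcal{F},\mu)$ be a probability space and let $1\le p<\infty$. For any real-valued $f,g\in L^\infty(S,\mu)$, $$\|fg-\mathbb{E}(fg)\|_p\le \|g\|_\infty\,\|f-\mathbb{E}f\|_p+\|f\|_\infty\,\|g-\mathbb{E}g\|_p.$$
   Context: Here $\mathbb{E}f=\int_S f\,d\mu$ (regarded as a constant function), $\|h\|_p=\left(\int_S|h|^p\,d\mu\right)^{1/p}$, and $\|\cdot\|_\infty$ is the essential supremum norm of $L^\infty(S,\mu)$. *)

theory Defs
  imports "HOL-Probability.Probability" "HOL-Probability.Essential_Supremum"
begin

text \<open>Elements of \<open>L\<^sup>p\<close> and \<open>L\<^sup>\<infinity>\<close> are represented by functions rather than by
  almost-everywhere classes; the (semi)norms below depend on the class only.\<close>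

definition Linf :: "'a measure \<Rightarrow> ('a \<Rightarrow> real) set" where
  "Linf M = {f \<in> borel_measurable M. esssup M (\<lambda>x. ereal \<bar>f x\<bar>) < \<infinity>}"

text \<open>Meaningful for \<open>f \<in> Linf M\<close>; \<^const>\<open>real_of_ereal\<close> maps infinite values to \<open>0\<close>.\<close>

definition Linf_norm :: "'a measure \<Rightarrow> ('a \<Rightarrow> real) \<Rightarrow> real" where
  "Linf_norm M f = real_of_ereal (esssup M (\<lambda>x. ereal \<bar>f x\<bar>))"

text \<open>Meaningful when \<open>\<lambda>x. \<bar>h x\<bar> powr p\<close> is integrable, which holds for \<open>h \<in> Linf M\<close> and \<open>p \<ge> 1\<close>
  on a probability space; the Bochner integral of a non-integrable function is \<open>0\<close>.\<close>

definition Lp_norm :: "'a measure \<Rightarrow> real \<Rightarrow> ('a \<Rightarrow> real) \<Rightarrow> real" where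
  "Lp_norm M p h = (\<integral>x. \<bar>h x\<bar> powr p \<partial>M) powr (1 / p)"

end

theory Submission
  imports Defs
begin

text \<open>
  Boundedness almost everywhere can be replaced by boundedness everywhere: truncating \<open>f\<close> and
  \<open>g\<close> at their essential suprema changes them only on null sets. Put \<open>u = f - E f\<close> and
  \<open>w = g - E g\<close>. Expanding gives a Leibniz decomposition that is symmetric in \<open>f\<close> and \<open>g\<close>:

  \<open>f g - E(f g) = (u g + u E g - E(u g)) / 2 + (w f + w E f - E(w f)) / 2\<close>.

  By Minkowski's inequality (\<open>Lp_norm_triangle\<close>) it is enough to bound the first half by
  \<open>\<parallel>g\<parallel>\<^sub>\<infinity> \<parallel>u\<parallel>\<^sub>p\<close>; the second is the same with \<open>f\<close> and \<open>g\<close> exchanged. The symmetry is essential.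
  The shorter decomposition \<open>f (g - E g) + (f E g - E(f g))\<close> does not suffice: for \<open>p = 1\<close>, for
  instance, the norm of its second summand can exceed \<open>\<parallel>g\<parallel>\<^sub>\<infinity> \<parallel>f - E f\<parallel>\<^sub>p\<close>.

  The bound on one half (\<open>Lp_norm_half_derivation_le\<close>) uses \<open>E u = 0\<close> to replace a weight: if
  \<open>y\<close> is an independent copy of \<open>x\<close>, the half at \<open>x\<close> is the expectation over \<open>y\<close> of

  \<open>(g x + g y) / 2 \<cdot> u x + (g x - g y) / 2 \<cdot> u y\<close>.

  The absolute values of the two weights add up to \<open>max \<bar>g x\<bar> \<bar>g y\<bar> \<le> \<parallel>g\<parallel>\<^sub>\<infinity>\<close>, and both are
  symmetric in \<open>x\<close> and \<open>y\<close>. By convexity of \<open>\<bar>t\<bar> powr p\<close> the \<open>p\<close>-th power of the half is, up to the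
  power of \<open>\<parallel>g\<parallel>\<^sub>\<infinity>\<close> dictated by homogeneity, at most the mean over \<open>y\<close> of the combination of
  \<open>\<bar>u x\<bar> powr p\<close> and \<open>\<bar>u y\<bar> powr p\<close> with these weights. After integrating over \<open>x\<close>, exchanging the names \<open>x\<close>
  and \<open>y\<close> in the second part brings both weights in front of the single function
  \<open>\<bar>u x\<bar> powr p\<close> (\<open>expectation_symmetric_weights_le\<close>).
\<close>

section \<open>Convexity of the power function\<close>

lemma powr_convex_combination_le:
  fixes p s t c d :: real
  assumes "1 \<le> p" "0 \<le> s" "0 \<le> t" "0 \<le> c" "0 \<le> d" "c + d = 1"
  shows "(c * s + d * t) powr p \<le> c * s powr p + d * t powr p"
proof -
  \<comment> \<open>Strict positivity is needed for \<open>powr_convex\<close>; when \<open>s\<close> or \<open>t\<close> vanishes, this bound replaces it.\<close>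
  have scale: "(r * z) powr p \<le> r * z powr p" if "0 \<le> r" "r \<le> 1" "0 \<le> z" for r z
  proof -
    have "r powr p \<le> r"
      using powr_mono'[of 1 p r] that assms(1) by simp
    then show ?thesis
      using that by (simp add: powr_mult mult_right_mono)
  qed
  consider "s = 0" | "t = 0" | "s > 0" "t > 0" using assms by linarith
  then show ?thesis
  proof cases
    case 3
    have c: "c = 1 - d" using assms(6) by simp
    show ?thesis
      using convex_onD[OF powr_convex[OF assms(1)], of d s t] 3 assms(4,5) unfolding c by simp
  qed (use scale[of d t] scale[of c s] assms in auto)
qed

text \<open>
  The weights are rescaled to sum \<open>1\<close>. Their total \<open>\<bar>a\<bar> + \<bar>b\<bar>\<close> enters with the nonnegative
  exponent \<open>p - 1\<close> and may therefore be enlarged to \<open>K\<close>.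
\<close>

lemma abs_powr_weighted_le:
  fixes p x y a b K :: real
  assumes "1 \<le> p" "\<bar>a\<bar> + \<bar>b\<bar> \<le> K"
  shows "\<bar>a * x + b * y\<bar> powr p \<le> K powr (p - 1) * (\<bar>a\<bar> * \<bar>x\<bar> powr p + \<bar>b\<bar> * \<bar>y\<bar> powr p)"
proof (cases "\<bar>a\<bar> + \<bar>b\<bar> = 0")
  case True
  then have "a = 0" "b = 0" by auto
  then show ?thesis by simp
next
  case False
  define r where "r = \<bar>a\<bar> + \<bar>b\<bar>"
  have r: "r > 0" using False unfolding r_def by linarith
  have "\<bar>a * x + b * y\<bar> \<le> r * (\<bar>a\<bar> / r * \<bar>x\<bar> + \<bar>b\<bar> / r * \<bar>y\<bar>)"
    using r abs_triangle_ineq[of "a * x" "b * y"] by (simp add: distrib_left abs_mult)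
  then have "\<bar>a * x + b * y\<bar> powr p \<le> (r * (\<bar>a\<bar> / r * \<bar>x\<bar> + \<bar>b\<bar> / r * \<bar>y\<bar>)) powr p"
    using assms by (intro powr_mono2) auto
  also have "\<dots> = r powr p * (\<bar>a\<bar> / r * \<bar>x\<bar> + \<bar>b\<bar> / r * \<bar>y\<bar>) powr p"
    using r by (simp add: powr_mult)
  also have "\<dots> \<le> r powr p * (\<bar>a\<bar> / r * \<bar>x\<bar> powr p + \<bar>b\<bar> / r * \<bar>y\<bar> powr p)"
    using r assms(1) unfolding r_def
    by (intro mult_left_mono powr_convex_combination_le) (auto simp: add_divide_distrib[symmetric])
  also have "\<dots> = r powr (p - 1) * (\<bar>a\<bar> * \<bar>x\<bar> powr p + \<bar>b\<bar> * \<bar>y\<bar> powr p)"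
    using r by (simp add: powr_diff field_simps)
  also have "\<dots> \<le> K powr (p - 1) * (\<bar>a\<bar> * \<bar>x\<bar> powr p + \<bar>b\<bar> * \<bar>y\<bar> powr p)"
    using assms r unfolding r_def by (intro mult_right_mono powr_mono2) auto
  finally show ?thesis .
qed

lemma convex_on_abs_powr:
  fixes p :: real
  assumes "1 \<le> p"
  shows "convex_on UNIV (\<lambda>x::real. \<bar>x\<bar> powr p)"
proof (rule convex_onI)
  fix t x y :: real
  assume "0 < t" "t < 1"
  then show "\<bar>(1 - t) *\<^sub>R x + t *\<^sub>R y\<bar> powr p \<le> (1 - t) * \<bar>x\<bar> powr p + t * \<bar>y\<bar> powr p"
    using abs_powr_weighted_le[OF assms, of "1 - t" t 1 x y] by simp
qed simp

section \<open>Minkowski's inequality\<close>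

lemma Lp_norm_powr:
  assumes "0 < p"
  shows "Lp_norm M p h powr p = (\<integral>x. \<bar>h x\<bar> powr p \<partial>M)"
  unfolding Lp_norm_def using assms by (simp add: powr_powr)

lemma Lp_norm_le:
  assumes "0 < p" "0 \<le> A" "(\<integral>x. \<bar>h x\<bar> powr p \<partial>M) \<le> A powr p"
  shows "Lp_norm M p h \<le> A"
proof -
  have "Lp_norm M p h \<le> (A powr p) powr (1 / p)"
    unfolding Lp_norm_def using assms by (intro powr_mono2) auto
  then show ?thesis using assms by (simp add: powr_powr)
qed

lemma Lp_norm_nonneg: "0 \<le> Lp_norm M p h"
  by (simp add: Lp_norm_def)

lemma Lp_norm_cong_AE:
  assumes [measurable]: "h \<in> borel_measurable M" "k \<in> borel_measurable M"
    and "AE x in M. h x = k x"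
  shows "Lp_norm M p h = Lp_norm M p k"
proof -
  have "(\<integral>x. \<bar>h x\<bar> powr p \<partial>M) = (\<integral>x. \<bar>k x\<bar> powr p \<partial>M)"
    by (rule integral_cong_AE) (use assms(3) in auto)
  then show ?thesis by (simp add: Lp_norm_def)
qed

text \<open>
  For \<open>\<parallel>h\<parallel>\<^sub>p < A\<close> and \<open>\<parallel>k\<parallel>\<^sub>p < B\<close>, writing \<open>h + k\<close> as the convex combination
  \<open>(A + B) (A / (A + B) \<cdot> h / A + B / (A + B) \<cdot> k / B)\<close> reduces the claim to convexity of the
  power. The slack \<open>e\<close> avoids treating functions of norm zero separately.
\<close>

lemma Lp_norm_triangle:
  assumes p: "1 \<le> p"
    and h: "integrable M (\<lambda>x. \<bar>h x\<bar> powr p)" and k: "integrable M (\<lambda>x. \<bar>k x\<bar> powr p)"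
    and hk: "integrable M (\<lambda>x. \<bar>h x + k x\<bar> powr p)"
  shows "Lp_norm M p (\<lambda>x. h x + k x) \<le> Lp_norm M p h + Lp_norm M p k"
proof (rule field_le_epsilon)
  fix e :: real assume e: "e > 0"
  define A where "A = Lp_norm M p h + e / 2"
  define B where "B = Lp_norm M p k + e / 2"
  have pos: "A > 0" "B > 0"
    using e Lp_norm_nonneg[of M p h] Lp_norm_nonneg[of M p k] by (auto simp: A_def B_def)
  have below: "(\<integral>x. \<bar>l x\<bar> powr p \<partial>M) / C powr p \<le> 1"
    if "Lp_norm M p l \<le> C" "C > 0" for l C
  proof -
    have "Lp_norm M p l powr p \<le> C powr p"
      using that p Lp_norm_nonneg[of M p l] by (intro powr_mono2) auto
    then show ?thesis using that p Lp_norm_powr[of p M l] by simp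
  qed
  have point: "\<bar>h x + k x\<bar> powr p
      \<le> (A + B) powr (p - 1) * (A * (\<bar>h x\<bar> powr p / A powr p) + B * (\<bar>k x\<bar> powr p / B powr p))" for x
    using abs_powr_weighted_le[OF p, of A B "A + B" "h x / A" "k x / B"] pos
    by (simp add: powr_divide)
  have "(\<integral>x. \<bar>h x + k x\<bar> powr p \<partial>M)
      \<le> (\<integral>x. (A + B) powr (p - 1) * (A * (\<bar>h x\<bar> powr p / A powr p) + B * (\<bar>k x\<bar> powr p / B powr p)) \<partial>M)"
    using h k by (intro integral_mono hk point) auto
  also have "\<dots> = (A + B) powr (p - 1) *
      (A * ((\<integral>x. \<bar>h x\<bar> powr p \<partial>M) / A powr p) + B * ((\<integral>x. \<bar>k x\<bar> powr p \<partial>M) / B powr p))"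
    using h k by simp
  also have "\<dots> \<le> (A + B) powr (p - 1) * (A * 1 + B * 1)"
    using below[of h A] below[of k B] pos e
    by (intro mult_left_mono add_mono) (auto simp: A_def B_def)
  also have "\<dots> = (A + B) powr p"
    using pos by (simp add: powr_diff)
  finally have "Lp_norm M p (\<lambda>x. h x + k x) \<le> A + B"
    using pos p by (intro Lp_norm_le) auto
  then show "Lp_norm M p (\<lambda>x. h x + k x) \<le> Lp_norm M p h + Lp_norm M p k + e"
    by (simp add: A_def B_def)
qed

section \<open>Half of the Leibniz decomposition\<close>

lemma abs_mult_le:
  fixes a b C D :: real
  assumes "\<bar>a\<bar> \<le> C" "\<bar>b\<bar> \<le> D"
  shows "\<bar>a * b\<bar> \<le> C * D"
  using mult_mono[OF assms] assms(1) by (simp add: abs_mult)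

lemma half_sum_half_diff_le:
  fixes a b K :: real
  assumes "\<bar>a\<bar> \<le> K" "\<bar>b\<bar> \<le> K"
  shows "\<bar>(a + b) / 2\<bar> + \<bar>(a - b) / 2\<bar> \<le> K"
  using assms by (auto simp: abs_if field_simps split: if_splits)

lemma (in prob_space) integrable_bounded:
  fixes h :: "'a \<Rightarrow> real"
  assumes "h \<in> borel_measurable M" "\<And>x. \<bar>h x\<bar> \<le> B"
  shows "integrable M h"
  using assms by (intro integrable_const_bound[where B = B]) auto

lemma (in prob_space) integrable_bounded_powr:
  fixes h :: "'a \<Rightarrow> real"
  assumes [measurable]: "h \<in> borel_measurable M" and "\<And>x. \<bar>h x\<bar> \<le> B" "0 \<le> p"
  shows "integrable M (\<lambda>x. \<bar>h x\<bar> powr p)"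
  using assms(2,3) by (intro integrable_bounded[where B = "B powr p"]) (auto intro: powr_mono2)

lemma (in prob_space) abs_expectation_powr_le:
  fixes X :: "'a \<Rightarrow> real"
  assumes "1 \<le> p" "X \<in> borel_measurable M" "\<And>x. \<bar>X x\<bar> \<le> B"
  shows "\<bar>expectation X\<bar> powr p \<le> expectation (\<lambda>x. \<bar>X x\<bar> powr p)"
  using assms
  by (intro jensens_inequality[where I = UNIV] convex_on_abs_powr
        integrable_bounded[where B = B] integrable_bounded_powr[where B = B]) auto

text \<open>
  The weights \<open>\<bar>v x + v y\<bar> / 2\<close> and \<open>\<bar>v x - v y\<bar> / 2\<close> are symmetric with sum at most \<open>K\<close>, so
  exchanging the two independent variables in the second term merges both terms.
\<close>

lemma (in prob_space) expectation_symmetric_weights_le: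
  fixes U v :: "'a \<Rightarrow> real"
  assumes [measurable]: "U \<in> borel_measurable M" "v \<in> borel_measurable M"
    and U: "\<And>x. 0 \<le> U x" "\<And>x. U x \<le> B" and v: "\<And>x. \<bar>v x\<bar> \<le> K"
  shows "(\<integral>x. (\<integral>y. \<bar>(v x + v y) / 2\<bar> * U x + \<bar>(v x - v y) / 2\<bar> * U y \<partial>M) \<partial>M) \<le> K * expectation U"
proof -
  interpret P: pair_prob_space M M ..
  have K: "0 \<le> K" using v[of undefined] by linarith
  note weight = half_sum_half_diff_le[OF v v]
  have plus: "\<bar>(v x + v y) / 2\<bar> \<le> K" and minus: "\<bar>(v x - v y) / 2\<bar> \<le> K" for x y
    using weight[of x y] by linarith+
  have absU: "\<bar>U x\<bar> \<le> B" for x using U by simp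
  let ?a = "\<lambda>(x, y). \<bar>(v x + v y) / 2\<bar> * U x"
  let ?b = "\<lambda>(x, y). \<bar>(v x - v y) / 2\<bar> * U y"
  let ?c = "\<lambda>(x, y). \<bar>(v x - v y) / 2\<bar> * U x"
  have int: "integrable (M \<Otimes>\<^sub>M M) ?a" "integrable (M \<Otimes>\<^sub>M M) ?b" "integrable (M \<Otimes>\<^sub>M M) ?c"
    using plus minus absU
    by (auto intro!: P.integrable_bounded[where B = "K * B"] abs_mult_le simp del: abs_divide)
  have intU: "integrable M U"
    by (rule integrable_bounded[where B = B]) (use U in auto)
  have intKU: "integrable (M \<Otimes>\<^sub>M M) (\<lambda>(x, y). K * U x)"
    using absU K by (auto intro!: P.integrable_bounded[where B = "K * B"] abs_mult_le)
  have "(\<integral>x. (\<integral>y. \<bar>(v x + v y) / 2\<bar> * U x + \<bar>(v x - v y) / 2\<bar> * U y \<partial>M) \<partial>M)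
      = (\<integral>z. ?a z + ?b z \<partial>(M \<Otimes>\<^sub>M M))"
    using P.integral_fst'[OF Bochner_Integration.integrable_add[OF int(1,2)]] by simp
  also have "\<dots> = (\<integral>z. ?a z \<partial>(M \<Otimes>\<^sub>M M)) + (\<integral>z. ?b z \<partial>(M \<Otimes>\<^sub>M M))"
    using int by (intro Bochner_Integration.integral_add)
  also have "(\<integral>z. ?b z \<partial>(M \<Otimes>\<^sub>M M)) = (\<integral>z. ?c z \<partial>(M \<Otimes>\<^sub>M M))"
  proof -
    have "(\<integral>(x, y). ?b (y, x) \<partial>(M \<Otimes>\<^sub>M M)) = (\<integral>z. ?b z \<partial>(M \<Otimes>\<^sub>M M))"
      by (rule P.integral_product_swap) measurable
    then show ?thesis by (simp add: abs_minus_commute)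
  qed
  also have "(\<integral>z. ?a z \<partial>(M \<Otimes>\<^sub>M M)) + (\<integral>z. ?c z \<partial>(M \<Otimes>\<^sub>M M)) = (\<integral>z. ?a z + ?c z \<partial>(M \<Otimes>\<^sub>M M))"
    using int by (intro Bochner_Integration.integral_add[symmetric])
  also have "\<dots> \<le> (\<integral>(x, y). K * U x \<partial>(M \<Otimes>\<^sub>M M))"
  proof (rule integral_mono)
    fix z :: "'a \<times> 'a"
    obtain x y where "z = (x, y)" by fastforce
    then show "?a z + ?c z \<le> (case z of (x, y) \<Rightarrow> K * U x)"
      using mult_right_mono[OF weight[of x y] U(1)[of x]] by (simp add: distrib_right)
  qed (use int intKU in auto)
  also have "\<dots> = K * expectation U"
    using P.integral_fst'[OF intKU] intU by (simp add: prob_space)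
  finally show ?thesis .
qed

text \<open>
  The hypothesis \<open>E u = 0\<close> allows adding \<open>v x E u / 2\<close>, which turns the map into the average
  over \<open>y\<close> of \<open>(v x + v y) / 2 \<cdot> u x + (v x - v y) / 2 \<cdot> u y\<close>. Without that change the
  coefficient of \<open>u y\<close> would be \<open>- v y / 2\<close>, which is not symmetric, and the absolute values
  of the two coefficients could add up to \<open>3 K / 2\<close>.
\<close>

lemma (in prob_space) Lp_norm_half_derivation_le:
  fixes u v :: "'a \<Rightarrow> real"
  assumes p: "1 \<le> p"
    and [measurable]: "u \<in> borel_measurable M" "v \<in> borel_measurable M"
    and u: "\<And>x. \<bar>u x\<bar> \<le> B" and v: "\<And>x. \<bar>v x\<bar> \<le> K"
    and u0: "expectation u = 0"
  shows "Lp_norm M p (\<lambda>x. (u x * v x + u x * expectation v - expectation (\<lambda>y. u y * v y)) / 2)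
    \<le> K * Lp_norm M p u"
proof -
  interpret P: pair_prob_space M M ..
  define h where "h x = (u x * v x + u x * expectation v - expectation (\<lambda>y. u y * v y)) / 2" for x
  define \<phi> where "\<phi> x y = (v x + v y) / 2 * u x + (v x - v y) / 2 * u y" for x y
  define \<psi> where "\<psi> x y = \<bar>(v x + v y) / 2\<bar> * \<bar>u x\<bar> powr p + \<bar>(v x - v y) / 2\<bar> * \<bar>u y\<bar> powr p" for x y
  have K: "0 \<le> K" using v[of undefined] by linarith
  note weight = half_sum_half_diff_le[OF v v]
  have plus: "\<bar>(v x + v y) / 2\<bar> \<le> K" and minus: "\<bar>(v x - v y) / 2\<bar> \<le> K" for x y
    using weight[of x y] by linarith+
  have up: "\<bar>\<bar>u x\<bar> powr p\<bar> \<le> B powr p" for x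
    using u[of x] p by (auto intro: powr_mono2)
  have [measurable]: "case_prod \<phi> \<in> borel_measurable (M \<Otimes>\<^sub>M M)"
    "case_prod \<psi> \<in> borel_measurable (M \<Otimes>\<^sub>M M)"
    unfolding \<phi>_def \<psi>_def by measurable
  have \<phi>_bound: "\<bar>\<phi> x y\<bar> \<le> K * B + K * B" for x y
    using abs_triangle_ineq[of "(v x + v y) / 2 * u x" "(v x - v y) / 2 * u y"]
      abs_mult_le[OF plus[of x y] u[of x]] abs_mult_le[OF minus[of x y] u[of y]] unfolding \<phi>_def by linarith
  have \<psi>_bound: "\<bar>\<psi> x y\<bar> \<le> K * B powr p + K * B powr p" for x y
    using abs_mult_le[OF plus[of x y] up[of x]] abs_mult_le[OF minus[of x y] up[of y]]
    unfolding \<psi>_def by (simp add: abs_mult)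
  have int: "integrable M u" "integrable M v" "integrable M (\<lambda>y. u y * v y)"
    by (rule integrable_bounded[OF _ u] integrable_bounded[OF _ v]
        integrable_bounded[OF _ abs_mult_le[OF u v]], measurable)+
  have h_eq: "h x = expectation (\<phi> x)" for x
  proof -
    have "\<phi> x = (\<lambda>y. (u x * v x + u x * v y + v x * u y - u y * v y) / 2)"
      unfolding \<phi>_def by (auto simp: field_simps)
    then have "expectation (\<phi> x) = expectation (\<lambda>y. (u x * v x + u x * v y + v x * u y - u y * v y) / 2)"
      by simp
    also have "\<dots> = (u x * v x + u x * expectation v + v x * expectation u
        - expectation (\<lambda>y. u y * v y)) / 2"
      using int by (simp add: prob_space)
    finally show ?thesis by (simp add: h_def u0)
  qed
  have point: "\<bar>h x\<bar> powr p \<le> K powr (p - 1) * expectation (\<psi> x)" for x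
  proof -
    have [measurable]: "\<phi> x \<in> borel_measurable M" "\<psi> x \<in> borel_measurable M"
      unfolding \<phi>_def \<psi>_def by measurable
    have "\<bar>h x\<bar> powr p \<le> expectation (\<lambda>y. \<bar>\<phi> x y\<bar> powr p)"
      unfolding h_eq by (rule abs_expectation_powr_le[OF p _ \<phi>_bound]) measurable
    also have "\<dots> \<le> expectation (\<lambda>y. K powr (p - 1) * \<psi> x y)"
    proof (rule integral_mono)
      show "integrable M (\<lambda>y. \<bar>\<phi> x y\<bar> powr p)"
        by (rule integrable_bounded_powr[OF _ \<phi>_bound]) (use p in auto)
      have "integrable M (\<psi> x)"
        by (rule integrable_bounded[OF _ \<psi>_bound]) measurable
      then show "integrable M (\<lambda>y. K powr (p - 1) * \<psi> x y)" by simp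
      show "\<bar>\<phi> x y\<bar> powr p \<le> K powr (p - 1) * \<psi> x y" for y
        unfolding \<phi>_def \<psi>_def by (rule abs_powr_weighted_le[OF p weight])
    qed
    finally show ?thesis by simp
  qed
  have "expectation (\<lambda>x. \<bar>h x\<bar> powr p) \<le> expectation (\<lambda>x. K powr (p - 1) * expectation (\<psi> x))"
  proof (rule integral_mono)
    have h_bound: "\<bar>h x\<bar> \<le> K * B + K * B" for x
    proof -
      have [measurable]: "\<phi> x \<in> borel_measurable M" unfolding \<phi>_def by measurable
      have "integrable M (\<phi> x)" by (rule integrable_bounded[OF _ \<phi>_bound]) measurable
      then have "expectation (\<lambda>y. \<bar>\<phi> x y\<bar>) \<le> K * B + K * B"
        by (intro integral_le_const AE_I2 \<phi>_bound) simp
      then show ?thesis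
        using integral_abs_bound[of M "\<phi> x"] unfolding h_eq by linarith
    qed
    have "h \<in> borel_measurable M" unfolding h_def[abs_def] by measurable
    then show "integrable M (\<lambda>x. \<bar>h x\<bar> powr p)"
      by (rule integrable_bounded_powr[OF _ h_bound]) (use p in simp)
    have "integrable (M \<Otimes>\<^sub>M M) (case_prod \<psi>)"
      by (rule P.integrable_bounded[where B = "K * B powr p + K * B powr p"])
        (use \<psi>_bound in \<open>auto split: prod.split\<close>)
    from P.integrable_fst'[OF this] show "integrable M (\<lambda>x. K powr (p - 1) * expectation (\<psi> x))"
      by simp
  qed (rule point)
  also have "\<dots> = K powr (p - 1) * (\<integral>x. expectation (\<psi> x) \<partial>M)" by simp
  also have "\<dots> \<le> K powr (p - 1) * (K * expectation (\<lambda>x. \<bar>u x\<bar> powr p))"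
    unfolding \<psi>_def[abs_def] using up v
    by (intro mult_left_mono expectation_symmetric_weights_le[where B = "B powr p"]) auto
  also have "\<dots> = (K * Lp_norm M p u) powr p"
    using K p Lp_norm_powr[of p M u] Lp_norm_nonneg[of M p u]
    by (cases "K = 0") (auto simp: powr_mult powr_diff)
  finally show ?thesis
    unfolding h_def[symmetric] using K p Lp_norm_nonneg[of M p u] by (intro Lp_norm_le) auto
qed

section \<open>The Leibniz inequality\<close>

lemma (in prob_space) Lp_norm_Leibniz_bounded:
  fixes f g :: "'a \<Rightarrow> real"
  assumes p: "1 \<le> p"
    and [measurable]: "f \<in> borel_measurable M" "g \<in> borel_measurable M"
    and f: "\<And>x. \<bar>f x\<bar> \<le> K" and g: "\<And>x. \<bar>g x\<bar> \<le> L"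
  shows "Lp_norm M p (\<lambda>x. f x * g x - expectation (\<lambda>y. f y * g y))
    \<le> L * Lp_norm M p (\<lambda>x. f x - expectation f) + K * Lp_norm M p (\<lambda>x. g x - expectation g)"
proof -
  define H where "H u v x = (u x * v x + u x * expectation v - expectation (\<lambda>y. u y * v y)) / 2"
    for u v :: "'a \<Rightarrow> real" and x
  define u where "u x = f x - expectation f" for x
  define w where "w x = g x - expectation g" for x
  have [measurable]: "u \<in> borel_measurable M" "w \<in> borel_measurable M"
    unfolding u_def w_def by measurable
  have u: "\<bar>u x\<bar> \<le> K + \<bar>expectation f\<bar>" and w: "\<bar>w x\<bar> \<le> L + \<bar>expectation g\<bar>" for x
    using f[of x] g[of x] unfolding u_def w_def by linarith+
  have int: "integrable M f" "integrable M g" "integrable M (\<lambda>x. f x * g x)"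
    by (rule integrable_bounded[OF _ f] integrable_bounded[OF _ g]
        integrable_bounded[OF _ abs_mult_le[OF f g]], measurable)+
  have half: "\<bar>(r + s - t) / 2\<bar> \<le> R + S + \<bar>t\<bar>" if "\<bar>r\<bar> \<le> R" "\<bar>s\<bar> \<le> S" for r s t R S :: real
    using that by (auto simp: abs_if field_simps split: if_splits)
  have H_integrable: "integrable M (\<lambda>x. \<bar>H a b x\<bar> powr p)"
    if [measurable]: "a \<in> borel_measurable M" "b \<in> borel_measurable M"
      and "\<And>x. \<bar>a x\<bar> \<le> C" "\<And>x. \<bar>b x\<bar> \<le> D" for a b C D
  proof (rule integrable_bounded_powr)
    show "H a b \<in> borel_measurable M" unfolding H_def[abs_def] by measurable
    show "\<bar>H a b x\<bar> \<le> C * D + C * \<bar>expectation b\<bar> + \<bar>expectation (\<lambda>y. a y * b y)\<bar>" for x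
      unfolding H_def by (intro half abs_mult_le that order_refl)
  qed (use p in simp)
  have mean0: "expectation u = 0" "expectation w = 0"
    unfolding u_def w_def using int by (auto simp: prob_space)
  have ug: "expectation (\<lambda>y. u y * g y) = expectation (\<lambda>y. f y * g y) - expectation f * expectation g"
    and wf: "expectation (\<lambda>y. w y * f y) = expectation (\<lambda>y. f y * g y) - expectation f * expectation g"
    unfolding u_def w_def using int
    by (simp_all add: left_diff_distrib mult.commute[of "g y" "f y" for y])
  have split: "f x * g x - expectation (\<lambda>y. f y * g y) = H u g x + H w f x" for x
    unfolding H_def ug wf by (simp add: u_def w_def field_simps)
  have "integrable M (\<lambda>x. \<bar>f x * g x - expectation (\<lambda>y. f y * g y)\<bar> powr p)"
  proof (rule integrable_bounded_powr)
    show "\<bar>f x * g x - expectation (\<lambda>y. f y * g y)\<bar> \<le> K * L + \<bar>expectation (\<lambda>y. f y * g y)\<bar>" for x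
      using abs_mult_le[OF f[of x] g[of x]] by linarith
  qed (use p in auto)
  then have "Lp_norm M p (\<lambda>x. H u g x + H w f x) \<le> Lp_norm M p (H u g) + Lp_norm M p (H w f)"
    unfolding split using p u w f g
    by (intro Lp_norm_triangle H_integrable) auto
  also have "\<dots> \<le> L * Lp_norm M p u + K * Lp_norm M p w"
    unfolding H_def[abs_def] using p u w f g mean0
    by (intro add_mono Lp_norm_half_derivation_le) auto
  finally show ?thesis unfolding split u_def[abs_def] w_def[abs_def] .
qed

lemma (in prob_space) AE_abs_le_Linf_norm:
  assumes "f \<in> Linf M"
  shows "AE x in M. \<bar>f x\<bar> \<le> Linf_norm M f" and "0 \<le> Linf_norm M f"
proof -
  let ?e = "esssup M (\<lambda>x. ereal \<bar>f x\<bar>)"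
  have "esssup M (\<lambda>x. ereal 0) \<le> ?e"
    using assms by (intro esssup_mono) auto
  then have "0 \<le> ?e"
    using esssup_const[of M "ereal 0"] by (simp add: emeasure_space_1 zero_ereal_def)
  moreover have "?e < \<infinity>" using assms by (simp add: Linf_def)
  ultimately have e: "?e = ereal (Linf_norm M f)"
    unfolding Linf_norm_def by (cases ?e) auto
  show "AE x in M. \<bar>f x\<bar> \<le> Linf_norm M f"
    using esssup_AE[of "\<lambda>x. ereal \<bar>f x\<bar>" M] unfolding e by simp
  show "0 \<le> Linf_norm M f"
    using \<open>0 \<le> ?e\<close> unfolding e by simp
qed

lemma (in prob_space) bounded_representative:
  assumes "f \<in> Linf M"
  obtains f' where "f' \<in> borel_measurable M" "AE x in M. f x = f' x" "\<And>x. \<bar>f' x\<bar> \<le> Linf_norm M f"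
proof
  let ?K = "Linf_norm M f"
  have [measurable]: "f \<in> borel_measurable M" using assms by (simp add: Linf_def)
  show "(\<lambda>x. max (- ?K) (min ?K (f x))) \<in> borel_measurable M" by measurable
  show "AE x in M. f x = max (- ?K) (min ?K (f x))"
    using AE_abs_le_Linf_norm(1)[OF assms] by eventually_elim auto
  show "\<bar>max (- ?K) (min ?K (f x))\<bar> \<le> ?K" for x
    using AE_abs_le_Linf_norm(2)[OF assms] by auto
qed

theorem theorem5p1:
  fixes M :: "'a measure" and p :: real and f g :: "'a \<Rightarrow> real"
  assumes "prob_space M"
    and "1 \<le> p"
    and "f \<in> Linf M" and "g \<in> Linf M"
  shows "Lp_norm M p (\<lambda>x. f x * g x - (\<integral>y. f y * g y \<partial>M))
    \<le> Linf_norm M g * Lp_norm M p (\<lambda>x. f x - (\<integral>y. f y \<partial>M))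
      + Linf_norm M f * Lp_norm M p (\<lambda>x. g x - (\<integral>y. g y \<partial>M))"
proof -
  interpret prob_space M by fact
  have [measurable]: "f \<in> borel_measurable M" "g \<in> borel_measurable M"
    using assms by (auto simp: Linf_def)
  obtain f' where [measurable]: "f' \<in> borel_measurable M"
    and f': "AE x in M. f x = f' x" "\<And>x. \<bar>f' x\<bar> \<le> Linf_norm M f"
    using bounded_representative[OF assms(3)] by blast
  obtain g' where [measurable]: "g' \<in> borel_measurable M"
    and g': "AE x in M. g x = g' x" "\<And>x. \<bar>g' x\<bar> \<le> Linf_norm M g"
    using bounded_representative[OF assms(4)] by blast
  have fg': "AE x in M. f x * g x = f' x * g' x"
    using f'(1) g'(1) by eventually_elim simp
  have centred: "Lp_norm M p (\<lambda>x. h x - expectation h) = Lp_norm M p (\<lambda>x. k x - expectation k)"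
    if [measurable]: "h \<in> borel_measurable M" "k \<in> borel_measurable M" and "AE x in M. h x = k x"
    for h k :: "'a \<Rightarrow> real"
  proof -
    have "expectation h = expectation k"
      using that by (intro integral_cong_AE)
    then show ?thesis
      using that(3) by (intro Lp_norm_cong_AE) auto
  qed
  show ?thesis
    using Lp_norm_Leibniz_bounded[OF assms(2) _ _ f'(2) g'(2)]
      centred[OF _ _ f'(1)] centred[OF _ _ g'(1)] centred[OF _ _ fg']
    by simp
qed

end
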